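(* Let $\mathcal{M}=\mathcal{M}(\Sigma,I)$ be an irreducible trace monoid with $|\Sigma|>1$. Then there exists a continuous family of different Bernoulli measures on $\partial\mathcal{M}$.
   Context: Trace monoids. An independence pair $(\Sigma,I)$ consists of a finite set $\Sigma$ (letters) and an irreflexive symmetric relation $I\subseteq\Sigma\times\Sigma$. The trace monoid is $\mathcal{M}=\mathcal{M}(\Sigma,I)=\langle\Sigma\mid\alpha\cdot\beta=\beta\cdot\alpha\text{ for }(\alpha,\beta)\in I\rangle$; its elements are called traces. It is irreducible if the undirected graph $(\Sigma,D)$, with $D=(\Sigma\times\Sigma)\setminus I$, is connected. Left divisibility: $u\leq v$ iff $v=u\cdot w$ for some $w\in\mathcal{M}$; this is a partial order. Boundary. Consider non-decreasing sequences $(u_k)_{k\geq0}$ in $(\mathcal{M},\leq)$, pre-ordered by $(u_k)\preccurlyeq(u'_k)$ iff for every $k$ there is $k'$ with $u_k\leq u'_{k'}$. Let $(\mathcal{W},\leq)$ be the partial order obtained by quotienting by the associated equivalence. $\mathcal{M}$ embeds in $\mathcal{W}$ through constant sequences. The boundary is $\partial\mathcal{M}=\mathcal{W}\setminus\mathcal{M}$. For $u\in\mathcal{M}$, $\uparrow u=\{\xi\in\partial\mathcal{M}: u\leq\xi\}$, and $\mathfrak{F}$ is the $\sigma$-algebra on $\partial\mathcal{M}$ generated by all sets $\uparrow u$, $u\in\mathcal{M}$. Bernoulli measures. A Bernoulli measure on $\partial\mathcal{M}$ is a probability measure $\mathbb{P}$ on $(\partial\mathcal{M},\mathfrak{F})$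 such that $\mathbb{P}(\uparrow u)>0$ for all $u\in\mathcal{M}$ and $\mathbb{P}(\uparrow(u\cdot v))=\mathbb{P}(\uparrow u)\,\mathbb{P}(\uparrow v)$ for all $u,v\in\mathcal{M}$. Its characteristic numbers are $\mathbb{P}(\uparrow\alpha)$, $\alpha\in\Sigma$; they determine $\mathbb{P}$. The source gives no formal definition of "continuous family"; it also describes the result informally as the existence of a continuum of distinct Bernoulli measures, obtained by small deformations of the characteristic numbers around those of the Bernoulli measure all of whose characteristic numbers are equal. *)

theory Defs
  imports "HOL-Algebra.Divisibility" "HOL-Probability.Probability"
begin

definition independence_pair :: "'a set \<Rightarrow> ('a \<times> 'a) set \<Rightarrow> bool" where
  "independence_pair \<Sigma> I \<longleftrightarrow> finite \<Sigma> \<and> I \<subseteq> \<Sigma> \<times> \<Sigma> \<and> irrefl I \<and> sym I"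

text \<open>The least congruence on the free monoid of words over \<open>\<Sigma>\<close> that identifies
  \<open>\<alpha>\<beta>\<close> and \<open>\<beta>\<alpha>\<close> for all \<open>(\<alpha>, \<beta>) \<in> I\<close>.\<close>

inductive_set trace_cong :: "'a set \<Rightarrow> ('a \<times> 'a) set \<Rightarrow> ('a list \<times> 'a list) set"
  for \<Sigma> :: "'a set" and I :: "('a \<times> 'a) set" where
  refl: "x \<in> lists \<Sigma> \<Longrightarrow> (x, x) \<in> trace_cong \<Sigma> I"
| sym: "(x, y) \<in> trace_cong \<Sigma> I \<Longrightarrow> (y, x) \<in> trace_cong \<Sigma> I"
| trans: "(x, y) \<in> trace_cong \<Sigma> I \<Longrightarrow> (y, z) \<in> trace_cong \<Sigma> I \<Longrightarrow> (x, z) \<in> trace_cong \<Sigma> I"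
| comm: "(a, b) \<in> I \<Longrightarrow> ([a, b], [b, a]) \<in> trace_cong \<Sigma> I"
| append: "(x, x') \<in> trace_cong \<Sigma> I \<Longrightarrow> (y, y') \<in> trace_cong \<Sigma> I
    \<Longrightarrow> (x @ y, x' @ y') \<in> trace_cong \<Sigma> I"

definition trace_monoid :: "'a set \<Rightarrow> ('a \<times> 'a) set \<Rightarrow> 'a list set monoid" where
  "trace_monoid \<Sigma> I =
    \<lparr>carrier = lists \<Sigma> // trace_cong \<Sigma> I,
     mult = (\<lambda>u v. \<Union>x\<in>u. \<Union>y\<in>v. trace_cong \<Sigma> I `` {x @ y}),
     one = trace_cong \<Sigma> I `` {[]}\<rparr>"

definition irreducible_trace_monoid :: "'a set \<Rightarrow> ('a \<times> 'a) set \<Rightarrow> bool" where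
  "irreducible_trace_monoid \<Sigma> I \<longleftrightarrow> (\<forall>\<alpha>\<in>\<Sigma>. \<forall>\<beta>\<in>\<Sigma>. (\<alpha>, \<beta>) \<in> (\<Sigma> \<times> \<Sigma> - I)\<^sup>*)"

text \<open>The boundary is defined for an arbitrary monoid; the library relation
  \<open>u divides\<^bsub>G\<^esub> v\<close> is left divisibility, \<open>v = u \<otimes>\<^bsub>G\<^esub> w\<close> for some \<open>w\<close>.\<close>

definition nondecreasing_seqs :: "('m, 'x) monoid_scheme \<Rightarrow> (nat \<Rightarrow> 'm) set" where
  "nondecreasing_seqs G =
    {u. (\<forall>k. u k \<in> carrier G) \<and> (\<forall>j k. j \<le> k \<longrightarrow> u j divides\<^bsub>G\<^esub> u k)}"

definition seq_le :: "('m, 'x) monoid_scheme \<Rightarrow> (nat \<Rightarrow> 'm) \<Rightarrow> (nat \<Rightarrow> 'm) \<Rightarrow> bool" where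
  "seq_le G u v \<longleftrightarrow> (\<forall>k. \<exists>k'. u k divides\<^bsub>G\<^esub> v k')"

definition seq_equiv :: "('m, 'x) monoid_scheme \<Rightarrow> ((nat \<Rightarrow> 'm) \<times> (nat \<Rightarrow> 'm)) set" where
  "seq_equiv G = {(u, v). u \<in> nondecreasing_seqs G \<and> v \<in> nondecreasing_seqs G
    \<and> seq_le G u v \<and> seq_le G v u}"

definition generalized_elements :: "('m, 'x) monoid_scheme \<Rightarrow> (nat \<Rightarrow> 'm) set set" where
  "generalized_elements G = nondecreasing_seqs G // seq_equiv G"

definition gen_le ::
    "('m, 'x) monoid_scheme \<Rightarrow> (nat \<Rightarrow> 'm) set \<Rightarrow> (nat \<Rightarrow> 'm) set \<Rightarrow> bool" where
  "gen_le G \<xi> \<zeta> \<longleftrightarrow> (\<exists>u\<in>\<xi>. \<exists>v\<in>\<zeta>. seq_le G u v)"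

definition gen_embed :: "('m, 'x) monoid_scheme \<Rightarrow> 'm \<Rightarrow> (nat \<Rightarrow> 'm) set" where
  "gen_embed G u = seq_equiv G `` {\<lambda>_. u}"

definition monoid_boundary :: "('m, 'x) monoid_scheme \<Rightarrow> (nat \<Rightarrow> 'm) set set" where
  "monoid_boundary G = generalized_elements G - gen_embed G ` carrier G"

definition cylinder :: "('m, 'x) monoid_scheme \<Rightarrow> 'm \<Rightarrow> (nat \<Rightarrow> 'm) set set" where
  "cylinder G u = {\<xi> \<in> monoid_boundary G. gen_le G (gen_embed G u) \<xi>}"

definition bernoulli_measure ::
    "('m, 'x) monoid_scheme \<Rightarrow> (nat \<Rightarrow> 'm) set measure \<Rightarrow> bool" where
  "bernoulli_measure G P \<longleftrightarrow>
    prob_space P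
    \<and> space P = monoid_boundary G
    \<and> sets P = sigma_sets (monoid_boundary G) (cylinder G ` carrier G)
    \<and> (\<forall>u\<in>carrier G. measure P (cylinder G u) > 0)
    \<and> (\<forall>u\<in>carrier G. \<forall>v\<in>carrier G.
        measure P (cylinder G (u \<otimes>\<^bsub>G\<^esub> v)) = measure P (cylinder G u) * measure P (cylinder G v))"

text \<open>Continuity is that of \<open>t \<mapsto> P t (\<up>u)\<close> for every element \<open>u\<close>. By multiplicativity this
  amounts to continuity of the characteristic numbers of \<open>P t\<close>.\<close>

definition continuous_family_of_bernoulli_measures ::
    "('m, 'x) monoid_scheme \<Rightarrow> (real \<Rightarrow> (nat \<Rightarrow> 'm) set measure) \<Rightarrow> bool" where
  "continuous_family_of_bernoulli_measures G P \<longleftrightarrow>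
    (\<forall>t\<in>{0..1}. bernoulli_measure G (P t))
    \<and> (\<forall>u\<in>carrier G. continuous_on {0..1} (\<lambda>t. measure (P t) (cylinder G u)))"

lemma trace_cong_lists:
  assumes "I \<subseteq> \<Sigma> \<times> \<Sigma>" "(x, y) \<in> trace_cong \<Sigma> I"
  shows "x \<in> lists \<Sigma> \<and> y \<in> lists \<Sigma>"
  using assms(2,1) by induction auto

lemma equiv_trace_cong:
  assumes "I \<subseteq> \<Sigma> \<times> \<Sigma>"
  shows "equiv (lists \<Sigma>) (trace_cong \<Sigma> I)"
proof (rule equivI)
  show "trace_cong \<Sigma> I \<subseteq> lists \<Sigma> \<times> lists \<Sigma>"
    using trace_cong_lists[OF assms] by auto
  show "refl_on (lists \<Sigma>) (trace_cong \<Sigma> I)"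
    by (auto simp: refl_on_def intro: trace_cong.refl)
  show "Relation.sym (trace_cong \<Sigma> I)"
    by (auto intro: symI trace_cong.sym)
  show "Relation.trans (trace_cong \<Sigma> I)"
    by (auto intro: transI trace_cong.trans)
qed

lemma trace_mult_class:
  assumes I: "I \<subseteq> \<Sigma> \<times> \<Sigma>" and xy: "x \<in> lists \<Sigma>" "y \<in> lists \<Sigma>"
  shows "(trace_cong \<Sigma> I `` {x}) \<otimes>\<^bsub>trace_monoid \<Sigma> I\<^esub> (trace_cong \<Sigma> I `` {y})
    = trace_cong \<Sigma> I `` {x @ y}"
proof -
  let ?c = "\<lambda>x. trace_cong \<Sigma> I `` {x}"
  have eq: "?c (x' @ y') = ?c (x @ y)" if "x' \<in> ?c x" "y' \<in> ?c y" for x' y'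
  proof -
    have "(x @ y, x' @ y') \<in> trace_cong \<Sigma> I"
      using that by (intro trace_cong.append) simp_all
    then show ?thesis
      by (rule equiv_class_eq[OF equiv_trace_cong[OF I], symmetric])
  qed
  have ne: "x \<in> ?c x" "y \<in> ?c y"
    using trace_cong.refl[OF xy(1)] trace_cong.refl[OF xy(2)] by simp_all
  have "(\<Union>x'\<in>?c x. \<Union>y'\<in>?c y. ?c (x' @ y')) = ?c (x @ y)"
  proof
    show "(\<Union>x'\<in>?c x. \<Union>y'\<in>?c y. ?c (x' @ y')) \<subseteq> ?c (x @ y)"
      by (intro UN_least equalityD1 eq)
    show "?c (x @ y) \<subseteq> (\<Union>x'\<in>?c x. \<Union>y'\<in>?c y. ?c (x' @ y'))"
      using ne by blast
  qed
  then show ?thesis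
    by (simp add: trace_monoid_def)
qed

lemma monoid_trace_monoid:
  assumes I: "I \<subseteq> \<Sigma> \<times> \<Sigma>"
  shows "monoid (trace_monoid \<Sigma> I)"
proof -
  let ?G = "trace_monoid \<Sigma> I" and ?c = "\<lambda>x. trace_cong \<Sigma> I `` {x}"
  have o: "\<one>\<^bsub>?G\<^esub> = ?c []"
    by (simp add: trace_monoid_def)
  have classI: "?c x \<in> carrier ?G" if "x \<in> lists \<Sigma>" for x
    using that by (simp add: trace_monoid_def quotientI)
  have classE: "\<exists>x\<in>lists \<Sigma>. u = ?c x" if "u \<in> carrier ?G" for u
    using that by (auto simp: trace_monoid_def elim: quotientE)
  have app: "x @ y \<in> lists \<Sigma>" if "x \<in> lists \<Sigma>" "y \<in> lists \<Sigma>" for x y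
    using that by simp
  have nil: "[] \<in> lists \<Sigma>"
    by simp
  note mult = trace_mult_class[OF I]
  show ?thesis
  proof (rule monoidI)
    show "\<one>\<^bsub>?G\<^esub> \<in> carrier ?G"
      unfolding o by (rule classI[OF nil])
    show "u \<otimes>\<^bsub>?G\<^esub> v \<in> carrier ?G" if "u \<in> carrier ?G" "v \<in> carrier ?G" for u v
      using classE[OF that(1)] classE[OF that(2)] by (metis mult app classI)
    show "u \<otimes>\<^bsub>?G\<^esub> v \<otimes>\<^bsub>?G\<^esub> w = u \<otimes>\<^bsub>?G\<^esub> (v \<otimes>\<^bsub>?G\<^esub> w)"
      if "u \<in> carrier ?G" "v \<in> carrier ?G" "w \<in> carrier ?G" for u v w
      using classE[OF that(1)] classE[OF that(2)] classE[OF that(3)]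
      by (metis mult app append_assoc)
    show "\<one>\<^bsub>?G\<^esub> \<otimes>\<^bsub>?G\<^esub> u = u" if "u \<in> carrier ?G" for u
      using classE[OF that] by (metis mult nil o append_Nil)
    show "u \<otimes>\<^bsub>?G\<^esub> \<one>\<^bsub>?G\<^esub> = u" if "u \<in> carrier ?G" for u
      using classE[OF that] by (metis mult nil o append_Nil2)
  qed
qed

end

theory Submission imports Defs begin

text \<open>
  Fix a letter \<open>a\<close>. A pyramid is a trace with exactly one \<open>a\<close>, this \<open>a\<close> being its only maximal
  letter. Give every letter other than \<open>a\<close> the same small weight \<open>s\<close> and give \<open>a\<close> the weight
  \<open>1 / Z(s)\<close>, where \<open>Z(s)\<close> sums \<open>s ^ (|w| - 1)\<close> over all pyramids \<open>w\<close>: the multiplicative weight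
  \<open>p\<close> is then a probability on pyramids. Multiplying independent random pyramids
  \<open>W\<^sub>1 W\<^sub>2 W\<^sub>3 \<dots>\<close> yields a random boundary point \<open>\<xi>\<close>, and \<open>P(u \<le> \<xi>) = p(u)\<close>: a trace all of
  whose maximal letters are \<open>a\<close> factors uniquely into pyramids, so \<open>W\<^sub>1 \<cdots> W\<^sub>n\<close> takes each such
  value \<open>x\<close> with \<open>n\<close> occurrences of \<open>a\<close> with probability \<open>p(x)\<close>. Writing \<open>x = u y\<close> and
  cancelling \<open>u\<close>, with \<open>k\<close> the number of \<open>a\<close> in \<open>u\<close>,
  \<open>P(u \<le> W\<^sub>1 \<cdots> W\<^sub>n\<^sub>+\<^sub>k) = p(u) P(u W\<^sub>1 \<cdots> W\<^sub>n has only maximal letter a)\<close>, and the last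
  probability tends to \<open>1\<close> because by irreducibility every letter of \<open>u\<close> almost surely occurs
  in some \<open>W\<^sub>i\<close>. The parameter is recovered from the measure as \<open>s = P(\<up>b)\<close> for any \<open>b \<noteq> a\<close>.
\<close>

section \<open>Random products of pyramids\<close>

text \<open>In the application \<open>height\<close> counts the occurrences of \<open>a\<close>, and \<open>capped\<close> consists of the traces
  without a maximal letter other than \<open>a\<close>.\<close>

locale pyramid_monoid = monoid G for G :: "('m, 'x) monoid_scheme" (structure) +
  fixes height :: "'m \<Rightarrow> nat" and letters :: "'m \<Rightarrow> 'b set" and capped :: "'m set"
    and weight :: "'m \<Rightarrow> real"
  assumes countable_carrier: "countable (carrier G)"
    and left_cancel: "\<lbrakk>u \<in> carrier G; x \<in> carrier G; y \<in> carrier G; u \<otimes> x = u \<otimes> y\<rbrakk> \<Longrightarrow> x = y"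
    and height_one: "height \<one> = 0"
    and height_mult: "\<lbrakk>x \<in> carrier G; y \<in> carrier G\<rbrakk> \<Longrightarrow> height (x \<otimes> y) = height x + height y"
    and finite_letters: "x \<in> carrier G \<Longrightarrow> finite (letters x)"
    and letters_mult: "\<lbrakk>x \<in> carrier G; y \<in> carrier G\<rbrakk> \<Longrightarrow> letters (x \<otimes> y) = letters x \<union> letters y"
    and capped_carrier: "capped \<subseteq> carrier G"
    and capped_one: "\<one> \<in> capped"
    and capped_height_0: "\<lbrakk>x \<in> capped; height x = 0\<rbrakk> \<Longrightarrow> x = \<one>"
    and capped_mult: "\<lbrakk>x \<in> capped; y \<in> capped\<rbrakk> \<Longrightarrow> x \<otimes> y \<in> capped"
    and capped_multD: "\<lbrakk>x \<in> carrier G; y \<in> carrier G; x \<otimes> y \<in> capped\<rbrakk> \<Longrightarrow> y \<in> capped"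
    and capped_cover: "\<lbrakk>u \<in> carrier G; y \<in> capped; letters u \<subseteq> letters y\<rbrakk> \<Longrightarrow> u \<otimes> y \<in> capped"
    and first_pyramid_exists: "\<lbrakk>x \<in> capped; height x = Suc n\<rbrakk>
      \<Longrightarrow> \<exists>w\<in>capped. \<exists>y\<in>carrier G. height w = 1 \<and> x = w \<otimes> y"
    and first_pyramid_unique: "\<lbrakk>w \<in> capped; w' \<in> capped; height w = 1; height w' = 1;
        y \<in> carrier G; y' \<in> carrier G; w \<otimes> y = w' \<otimes> y'\<rbrakk> \<Longrightarrow> w = w'"
    and letter_in_pyramid: "\<lbrakk>u \<in> carrier G; b \<in> letters u\<rbrakk>
      \<Longrightarrow> \<exists>w\<in>capped. height w = 1 \<and> b \<in> letters w"
    and weight_pos: "x \<in> carrier G \<Longrightarrow> weight x > 0"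
    and weight_one: "weight \<one> = 1"
    and weight_mult: "\<lbrakk>x \<in> carrier G; y \<in> carrier G\<rbrakk> \<Longrightarrow> weight (x \<otimes> y) = weight x * weight y"
    and weight_pyramids:
      "(\<integral>\<^sup>+w. ennreal (weight w) \<partial>count_space {w \<in> capped. height w = 1}) = 1"
begin

text \<open>By \<open>pyr_mult\<close> and \<open>pyr_SucE\<close> these are the products of
  \<open>n\<close> pyramids, so \<open>pyr (Suc 0)\<close> is the set of pyramids.\<close>

definition pyr :: "nat \<Rightarrow> 'm set" where
  "pyr n = {x \<in> capped. height x = n}"

definition step_measure :: "'m measure" where
  "step_measure = point_measure (pyr (Suc 0)) (\<lambda>w. ennreal (weight w))"

abbreviation path_measure :: "'m stream measure" where
  "path_measure \<equiv> stream_space step_measure"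

text \<open>Recursion at the head of the stream matches conditioning on the first pyramid.
  \<open>partial_prod_Suc_right\<close> supplies the recursion at the other end, from which
  divisibility is read off.\<close>

primrec partial_prod :: "nat \<Rightarrow> 'm stream \<Rightarrow> 'm" where
  "partial_prod 0 \<omega> = \<one>"
| "partial_prod (Suc n) \<omega> = shd \<omega> \<otimes> partial_prod n (stl \<omega>)"

definition limit_point :: "'m stream \<Rightarrow> (nat \<Rightarrow> 'm) set" where
  "limit_point \<omega> = seq_equiv G `` {\<lambda>n. partial_prod n \<omega>}"

definition boundary_law :: "(nat \<Rightarrow> 'm) set measure" where
  "boundary_law = distr path_measure
     (sigma (monoid_boundary G) (cylinder G ` carrier G)) limit_point"

section \<open>Factorizations into pyramids and chains of partial products\<close>

lemma pyr_carrier: "x \<in> pyr n \<Longrightarrow> x \<in> carrier G"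
  using capped_carrier by (auto simp: pyr_def)

lemma pyr_0: "pyr 0 = {\<one>}"
  unfolding pyr_def using capped_one height_one capped_height_0 by blast

lemma pyr_mult: "\<lbrakk>x \<in> pyr m; y \<in> pyr n\<rbrakk> \<Longrightarrow> x \<otimes> y \<in> pyr (m + n)"
  using capped_mult capped_carrier height_mult by (auto simp: pyr_def subset_iff)

lemma countable_pyr: "countable (pyr n)"
  by (rule countable_subset[OF _ countable_carrier]) (auto dest: pyr_carrier)

text \<open>Splits off the first pyramid; the rest is again capped because right factors of capped
  traces are.\<close>

lemma pyr_SucE:
  assumes "x \<in> pyr (Suc n)"
  obtains w y where "w \<in> pyr (Suc 0)" "y \<in> pyr n" "x = w \<otimes> y"
proof -
  from assms have "x \<in> capped" "height x = Suc n"
    by (auto simp: pyr_def)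
  from first_pyramid_exists[OF this] obtain w y
    where *: "w \<in> capped" "y \<in> carrier G" "height w = 1" "x = w \<otimes> y"
    by blast
  then have "y \<in> capped"
    using capped_multD[of w y] capped_carrier \<open>x \<in> capped\<close> by auto
  moreover have "height y = n"
    using * height_mult[of w y] capped_carrier \<open>height x = Suc n\<close> by auto
  ultimately show thesis
    using * by (intro that[of w y]) (auto simp: pyr_def)
qed

lemma space_step_measure [simp]: "space step_measure = pyr (Suc 0)"
  by (simp add: step_measure_def space_point_measure)

lemma sets_step_measure [simp]: "sets step_measure = Pow (pyr (Suc 0))"
  by (simp add: step_measure_def sets_point_measure)

lemma space_path_measure [simp]: "space path_measure = streams (pyr (Suc 0))"
  by (simp add: space_stream_space)

lemma nn_integral_step_measure:
  "(\<integral>\<^sup>+w. f w \<partial>step_measure) = (\<integral>\<^sup>+w. ennreal (weight w) * f w \<partial>count_space (pyr (Suc 0)))"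
  unfolding step_measure_def point_measure_def by (subst nn_integral_density) auto

sublocale step: prob_space step_measure
proof
  have "emeasure step_measure (space step_measure) = (\<integral>\<^sup>+w. 1 \<partial>step_measure)"
    by simp
  also have "\<dots> = 1"
    using weight_pyramids unfolding nn_integral_step_measure by (simp add: pyr_def)
  finally show "emeasure step_measure (space step_measure) = 1" .
qed

sublocale path: prob_space path_measure
  by (rule step.prob_space_stream_space)

lemma shd_stl_streams:
  assumes "\<omega> \<in> streams A"
  shows "shd \<omega> \<in> A" "stl \<omega> \<in> streams A"
  using assms by (cases \<omega>; simp)+

lemma partial_prod_pyr: "\<omega> \<in> streams (pyr (Suc 0)) \<Longrightarrow> partial_prod n \<omega> \<in> pyr n"
proof (induction n arbitrary: \<omega>)
  case (Suc n)
  then show ?case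
    using pyr_mult[of "shd \<omega>" "Suc 0" "partial_prod n (stl \<omega>)" n] by (auto dest: shd_stl_streams)
qed (simp add: pyr_0)

lemma partial_prod_carrier: "\<omega> \<in> streams (pyr (Suc 0)) \<Longrightarrow> partial_prod n \<omega> \<in> carrier G"
  using partial_prod_pyr pyr_carrier by blast

lemma partial_prod_Suc_right:
  "\<omega> \<in> streams (pyr (Suc 0)) \<Longrightarrow> partial_prod (Suc n) \<omega> = partial_prod n \<omega> \<otimes> \<omega> !! n"
proof (induction n arbitrary: \<omega>)
  case 0
  then show ?case
    using pyr_carrier by (auto dest: shd_stl_streams)
next
  case (Suc n)
  note st = shd_stl_streams[OF Suc.prems]
  have "stl \<omega> !! n \<in> pyr (Suc 0)"
    using st(2) by (metis snth_in streams_iff_sset)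
  then show ?case
    using Suc.IH[OF st(2)] st(1) partial_prod_carrier[OF st(2), of n] pyr_carrier
    by (simp add: m_assoc)
qed

lemma partial_prod_divides:
  assumes "\<omega> \<in> streams (pyr (Suc 0))" "m \<le> n"
  shows "partial_prod m \<omega> divides partial_prod n \<omega>"
  using assms(2)
proof (induction rule: dec_induct)
  case base
  show ?case
    using partial_prod_carrier[OF assms(1)] by (rule divides_refl)
next
  case (step n)
  have "\<omega> !! n \<in> carrier G"
    using assms(1) pyr_carrier by (metis snth_in streams_iff_sset)
  then have "partial_prod n \<omega> divides partial_prod (Suc n) \<omega>"
    unfolding partial_prod_Suc_right[OF assms(1)] by (auto simp: factor_def)
  with step.IH show ?case
    using partial_prod_carrier[OF assms(1)] divides_trans by blast
qed

lemma partial_prod_letters: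
  assumes "\<omega> \<in> streams (pyr (Suc 0))" "i < n"
  shows "letters (\<omega> !! i) \<subseteq> letters (partial_prod n \<omega>)"
proof -
  have i: "\<omega> !! i \<in> carrier G"
    using assms(1) pyr_carrier by (metis snth_in streams_iff_sset)
  have "partial_prod (Suc i) \<omega> divides partial_prod n \<omega>"
    using assms by (intro partial_prod_divides) auto
  then obtain z where "z \<in> carrier G" "partial_prod n \<omega> = partial_prod (Suc i) \<omega> \<otimes> z"
    unfolding factor_def by blast
  then have "letters (partial_prod n \<omega>) = letters (partial_prod i \<omega>) \<union> letters (\<omega> !! i) \<union> letters z"
    using i partial_prod_carrier[OF assms(1)]
    by (simp add: partial_prod_Suc_right[OF assms(1)] letters_mult del: partial_prod.simps)
  then show ?thesis
    by blast
qed

section \<open>Distribution of the partial products and of their divisors\<close>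

lemma measurable_partial_prod [measurable]:
  "{\<omega> \<in> space path_measure. partial_prod n \<omega> \<in> A} \<in> sets path_measure"
proof (induction n arbitrary: A)
  case 0
  show ?case by (cases "\<one> \<in> A") (auto simp del: space_path_measure)
next
  case (Suc n)
  \<comment> \<open>Split according to the first pyramid \<open>w\<close>, of which there are
    countably many. The rest of the path then has to hit the preimage of \<open>A\<close> under left
    multiplication by \<open>w\<close>, which is why the induction runs over all sets
    \<open>A\<close>.\<close>
  have "{\<omega> \<in> space path_measure. partial_prod (Suc n) \<omega> \<in> A}
      = (\<Union>w\<in>pyr (Suc 0). {\<omega> \<in> space path_measure. shd \<omega> \<in> {w}} \<inter>
          (stl -` {\<omega> \<in> space path_measure. partial_prod n \<omega> \<in> {x. w \<otimes> x \<in> A}} \<inter> space path_measure))"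
    by (auto dest: shd_stl_streams)
  also have "\<dots> \<in> sets path_measure"
  proof (rule sets.countable_UN''[OF countable_pyr])
    fix w assume "w \<in> pyr (Suc 0)"
    then have "{w} \<in> sets step_measure"
      by simp
    then have "shd -` {w} \<inter> space path_measure \<in> sets path_measure"
      by (rule measurable_sets[OF measurable_shd])
    also have "shd -` {w} \<inter> space path_measure = {\<omega> \<in> space path_measure. shd \<omega> \<in> {w}}"
      by auto
    finally show "{\<omega> \<in> space path_measure. shd \<omega> \<in> {w}} \<inter>
        (stl -` {\<omega> \<in> space path_measure. partial_prod n \<omega> \<in> {x. w \<otimes> x \<in> A}} \<inter> space path_measure)
        \<in> sets path_measure"
      by (rule sets.Int[OF _ measurable_sets[OF measurable_stl Suc.IH]])
  qed
  finally show ?case .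
qed

text \<open>A product of pyramids determines its first factor and, by cancellation, the product of
  the others. So exactly one first step can lead to \<open>x\<close>, and independence of the later
  steps multiplies the weights.\<close>

lemma emeasure_partial_prod_eq:
  "emeasure path_measure {\<omega> \<in> space path_measure. partial_prod n \<omega> = x}
    = (if x \<in> pyr n then ennreal (weight x) else 0)"
proof (cases "x \<in> pyr n")
  case False
  then have "{\<omega> \<in> space path_measure. partial_prod n \<omega> = x} = {}"
    using partial_prod_pyr by auto
  with False show ?thesis by (simp only: emeasure_empty if_False)
next
  case True
  then show ?thesis
  proof (induction n arbitrary: x)
    case 0
    then show ?case
      using path.emeasure_space_1 by (simp add: pyr_0 weight_one)
  next
    case (Suc n)
    from Suc.prems obtain w y where wy: "w \<in> pyr (Suc 0)" "y \<in> pyr n" "x = w \<otimes> y"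
      by (rule pyr_SucE)
    let ?E = "\<lambda>n x. {\<omega> \<in> space path_measure. partial_prod n \<omega> = x}"
    have fib: "{\<omega> \<in> space path_measure. t ## \<omega> \<in> ?E (Suc n) x} = (if t = w then ?E n y else {})"
      if t: "t \<in> pyr (Suc 0)" for t
    proof -
      have "t = w \<and> partial_prod n \<omega> = y"
        if "\<omega> \<in> streams (pyr (Suc 0))" "t \<otimes> partial_prod n \<omega> = x" for \<omega>
      proof -
        have c: "partial_prod n \<omega> \<in> carrier G" "y \<in> carrier G" "w \<in> carrier G"
          using partial_prod_carrier[OF that(1)] wy pyr_carrier by auto
        have "t = w"
          using first_pyramid_unique[of t w "partial_prod n \<omega>" y] c t wy that(2)
          by (auto simp: pyr_def)
        then show ?thesis
          using left_cancel[of w "partial_prod n \<omega>" y] c wy(3) that(2) by auto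
      qed
      then show ?thesis
        using t wy by auto
    qed
    have "emeasure path_measure (?E (Suc n) x)
        = (\<integral>\<^sup>+t. emeasure path_measure {\<omega> \<in> space path_measure. t ## \<omega> \<in> ?E (Suc n) x} \<partial>step_measure)"
      using measurable_partial_prod[of "Suc n" "{x}"]
      by (intro step.emeasure_stream_space) simp
    also have "\<dots> = (\<integral>\<^sup>+t. ennreal (weight y) * indicator {w} t \<partial>step_measure)"
    proof (rule nn_integral_cong)
      fix t assume "t \<in> space step_measure"
      then have "t \<in> pyr (Suc 0)"
        by simp
      then show "emeasure path_measure {\<omega> \<in> space path_measure. t ## \<omega> \<in> ?E (Suc n) x}
          = ennreal (weight y) * indicator {w} t"
        unfolding fib[OF \<open>t \<in> pyr (Suc 0)\<close>] using Suc.IH[OF wy(2)] wy(2) by simp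
    qed
    also have "\<dots> = ennreal (weight y) * emeasure step_measure {w}"
      using wy(1) by (intro nn_integral_cmult_indicator) simp
    also have "emeasure step_measure {w} = (\<integral>\<^sup>+t. indicator {w} t \<partial>step_measure)"
      using wy(1) by simp
    also have "\<dots> = ennreal (weight w)"
      unfolding nn_integral_step_measure using wy(1) by simp
    also have "ennreal (weight y) * ennreal (weight w) = ennreal (weight x)"
      using wy pyr_carrier weight_pos[of w] weight_pos[of y]
      by (simp add: weight_mult ennreal_mult' less_imp_le mult.commute)
    finally show ?case
      using Suc.prems by simp
  qed
qed

lemma emeasure_partial_prod:
  "emeasure path_measure {\<omega> \<in> space path_measure. partial_prod n \<omega> \<in> A}
    = (\<integral>\<^sup>+x. ennreal (weight x) \<partial>count_space (A \<inter> pyr n))"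
proof -
  have "{\<omega> \<in> space path_measure. partial_prod n \<omega> \<in> A}
      = (\<Union>x\<in>A \<inter> pyr n. {\<omega> \<in> space path_measure. partial_prod n \<omega> = x})"
    using partial_prod_pyr by auto
  also have "emeasure path_measure \<dots>
      = (\<integral>\<^sup>+x. emeasure path_measure {\<omega> \<in> space path_measure. partial_prod n \<omega> = x} \<partial>count_space (A \<inter> pyr n))"
    using measurable_partial_prod[of n "{x}" for x] countable_pyr
    by (intro emeasure_UN_countable) (auto simp: disjoint_family_on_def)
  also have "\<dots> = (\<integral>\<^sup>+x. ennreal (weight x) \<partial>count_space (A \<inter> pyr n))"
    by (intro nn_integral_cong) (simp add: emeasure_partial_prod_eq del: space_path_measure)
  finally show ?thesis .
qed

text \<open>Left multiplication by \<open>u\<close> maps the \<open>y\<close> in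
  \<open>pyr n\<close> with \<open>u \<otimes> y\<close> capped bijectively onto the multiples of
  \<open>u\<close> in \<open>pyr (n + height u)\<close>: injectively by cancellation, onto because a
  right factor of a capped trace is capped. It scales every weight by
  \<open>weight u\<close>.\<close>

lemma prob_divides_partial_prod:
  assumes u: "u \<in> carrier G"
  shows "path.prob {\<omega> \<in> space path_measure. u divides partial_prod (n + height u) \<omega>}
    = weight u * path.prob {\<omega> \<in> space path_measure. u \<otimes> partial_prod n \<omega> \<in> capped}"
proof -
  let ?A = "{x. u divides x} \<inter> pyr (n + height u)" and ?B = "{y. u \<otimes> y \<in> capped} \<inter> pyr n"
  have bij: "bij_betw (\<lambda>y. u \<otimes> y) ?B ?A"
  proof (rule bij_betwI')
    show "(u \<otimes> x = u \<otimes> y) = (x = y)" if "x \<in> ?B" "y \<in> ?B" for x y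
      using that left_cancel[OF u, of x y] pyr_carrier[of x n] pyr_carrier[of y n] by blast
    show "u \<otimes> x \<in> ?A" if "x \<in> ?B" for x
      using that u pyr_carrier[of x n] by (auto simp: pyr_def height_mult factor_def)
    show "\<exists>y\<in>?B. x = u \<otimes> y" if x: "x \<in> ?A" for x
    proof -
      from x obtain y where y: "y \<in> carrier G" "x = u \<otimes> y"
        unfolding factor_def by blast
      then have "u \<otimes> y \<in> capped" "height y = n"
        using x u by (auto simp: pyr_def height_mult)
      then show ?thesis
        using y u capped_multD[of u y] by (auto simp: pyr_def)
    qed
  qed
  have "emeasure path_measure {\<omega> \<in> space path_measure. u divides partial_prod (n + height u) \<omega>}
      = (\<integral>\<^sup>+x. ennreal (weight x) \<partial>count_space ?A)"
    using emeasure_partial_prod[of "n + height u" "{x. u divides x}"] by simp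
  also have "\<dots> = (\<integral>\<^sup>+y. ennreal (weight (u \<otimes> y)) \<partial>count_space ?B)"
    by (rule nn_integral_bij_count_space[OF bij, symmetric])
  also have "\<dots> = (\<integral>\<^sup>+y. ennreal (weight u) * ennreal (weight y) \<partial>count_space ?B)"
    using u by (intro nn_integral_cong)
      (auto dest!: pyr_carrier simp: weight_mult weight_pos less_imp_le ennreal_mult')
  also have "\<dots> = ennreal (weight u) * (\<integral>\<^sup>+y. ennreal (weight y) \<partial>count_space ?B)"
    by (intro nn_integral_cmult) simp
  also have "\<dots> = ennreal (weight u)
      * emeasure path_measure {\<omega> \<in> space path_measure. u \<otimes> partial_prod n \<omega> \<in> capped}"
    using emeasure_partial_prod[of n "{y. u \<otimes> y \<in> capped}"] by simp
  finally show ?thesis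
    using weight_pos[OF u] by (simp add: measure_def enn2real_mult)
qed

text \<open>Conditioning on the first pyramid gives \<open>q = q * p\<close>, where \<open>q\<close>
  is the probability that \<open>b\<close> never occurs and \<open>p\<close> that of a single
  pyramid without \<open>b\<close>. Since \<open>w\<close> has positive weight,
  \<open>p < 1\<close>, and therefore \<open>q = 0\<close>.\<close>

lemma AE_letter_occurs:
  assumes w: "w \<in> pyr (Suc 0)" "b \<in> letters w"
  shows "AE \<omega> in path_measure. \<exists>i. b \<in> letters (\<omega> !! i)"
proof -
  let ?N = "{\<omega> \<in> space path_measure. \<forall>i. b \<notin> letters (\<omega> !! i)}"
  let ?W = "{v \<in> pyr (Suc 0). b \<notin> letters v}"
  have [measurable]: "Measurable.pred step_measure (\<lambda>v. b \<notin> letters v)"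
    by (auto simp: pred_def)
  have N: "?N \<in> sets path_measure"
    by measurable
  have "emeasure path_measure ?N
      = (\<integral>\<^sup>+t. emeasure path_measure {\<omega> \<in> space path_measure. t ## \<omega> \<in> ?N} \<partial>step_measure)"
    by (rule step.emeasure_stream_space[OF N])
  also have "\<dots> = (\<integral>\<^sup>+t. emeasure path_measure ?N * indicator ?W t \<partial>step_measure)"
  proof (intro nn_integral_cong)
    fix t assume "t \<in> space step_measure"
    then have "{\<omega> \<in> space path_measure. t ## \<omega> \<in> ?N} = (if t \<in> ?W then ?N else {})"
      by (auto simp: Stream_snth split: nat.splits)
    then show "emeasure path_measure {\<omega> \<in> space path_measure. t ## \<omega> \<in> ?N}
        = emeasure path_measure ?N * indicator ?W t"
      by (simp del: space_path_measure)
  qed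
  also have "\<dots> = emeasure path_measure ?N * emeasure step_measure ?W"
    by (intro nn_integral_cmult_indicator) auto
  finally have "path.prob ?N = path.prob ?N * step.prob ?W"
    unfolding measure_def enn2real_mult[symmetric] by (rule arg_cong)
  moreover have "step.prob ?W < 1"
  proof -
    have "emeasure step_measure {w} = (\<integral>\<^sup>+t. indicator {w} t \<partial>step_measure)"
      using w(1) by simp
    also have "\<dots> = ennreal (weight w)"
      unfolding nn_integral_step_measure using w(1) by simp
    finally have "step.prob {w} > 0"
      using weight_pos[of w] pyr_carrier[OF w(1)] by (simp add: measure_def)
    moreover have "step.prob ?W + step.prob {w} = step.prob (?W \<union> {w})"
      using w by (intro step.finite_measure_Union[symmetric]) auto
    ultimately show ?thesis
      using step.prob_le_1[of "?W \<union> {w}"] by linarith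
  qed
  ultimately have "path.prob ?N = 0"
    unfolding mult_cancel_left1 by (elim disjE) linarith+
  then have "emeasure path_measure ?N = 0"
    by (simp add: path.emeasure_eq_measure)
  then show ?thesis
    by (intro AE_I[OF _ _ N]) auto
qed

text \<open>Let \<open>n\<close> tend to infinity in \<open>prob_divides_partial_prod\<close>. Both
  events increase with \<open>n\<close>, and the one on the right exhausts almost all paths because
  every letter of \<open>u\<close> eventually occurs.\<close>

lemma prob_divides_limit:
  assumes u: "u \<in> carrier G"
  shows "path.prob {\<omega> \<in> space path_measure. \<exists>n. u divides partial_prod n \<omega>} = weight u"
proof -
  let ?E = "\<lambda>n. {\<omega> \<in> space path_measure. u divides partial_prod n \<omega>}"
  let ?F = "\<lambda>n. {\<omega> \<in> space path_measure. u \<otimes> partial_prod n \<omega> \<in> capped}"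
  have E: "range ?E \<subseteq> sets path_measure"
    using measurable_partial_prod[of n "{x. u divides x}" for n] by auto
  have F: "range ?F \<subseteq> sets path_measure"
    using measurable_partial_prod[of n "{x. u \<otimes> x \<in> capped}" for n] by auto
  have "incseq ?E"
    by (intro incseq_SucI) (auto simp del: partial_prod.simps
        intro: divides_trans[OF _ partial_prod_divides u] )
  from path.finite_Lim_measure_incseq[OF E this]
  have limE: "(\<lambda>n. path.prob (?E n)) \<longlonglongrightarrow> path.prob (\<Union>n. ?E n)" .
  \<comment> \<open>Once \<open>u \<otimes> partial_prod n \<omega>\<close> is capped it stays so,
    since each further step multiplies it on the right by a capped trace.\<close>
  have "incseq ?F"
  proof (intro incseq_SucI subsetI)
    fix n \<omega> assume "\<omega> \<in> ?F n"
    then have \<omega>: "\<omega> \<in> streams (pyr (Suc 0))" "u \<otimes> partial_prod n \<omega> \<in> capped"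
      by auto
    have w: "\<omega> !! n \<in> pyr (Suc 0)"
      using \<omega>(1) by (metis snth_in streams_iff_sset)
    then have "(u \<otimes> partial_prod n \<omega>) \<otimes> \<omega> !! n \<in> capped"
      using capped_mult[OF \<omega>(2)] by (simp add: pyr_def)
    then show "\<omega> \<in> ?F (Suc n)"
      using \<omega>(1) u partial_prod_carrier[OF \<omega>(1)] pyr_carrier[OF w]
      by (simp add: partial_prod_Suc_right m_assoc del: partial_prod.simps)
  qed
  from path.finite_Lim_measure_incseq[OF F this]
  have limF: "(\<lambda>n. path.prob (?F n)) \<longlonglongrightarrow> path.prob (\<Union>n. ?F n)" .
  have "AE \<omega> in path_measure. \<forall>b\<in>letters u. \<exists>i. b \<in> letters (\<omega> !! i)"
  proof (rule AE_finite_allI[OF finite_letters[OF u]])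
    fix b assume "b \<in> letters u"
    then obtain w where "w \<in> capped" "height w = 1" "b \<in> letters w"
      using letter_in_pyramid[OF u] by blast
    then show "AE \<omega> in path_measure. \<exists>i. b \<in> letters (\<omega> !! i)"
      by (intro AE_letter_occurs[of w]) (simp_all add: pyr_def)
  qed
  then have "AE \<omega> in path_measure. \<omega> \<in> (\<Union>n. ?F n)"
    using AE_space
  proof eventually_elim
    fix \<omega> assume occ: "\<forall>b\<in>letters u. \<exists>i. b \<in> letters (\<omega> !! i)" and "\<omega> \<in> space path_measure"
    then have \<omega>: "\<omega> \<in> streams (pyr (Suc 0))"
      by simp
    from occ obtain f where f: "\<And>b. b \<in> letters u \<Longrightarrow> b \<in> letters (\<omega> !! f b)"
      by metis
    \<comment> \<open>Finitely many letters have a common bound \<open>n\<close> on their chosen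
      occurrence times \<open>f b\<close>; from then on \<open>capped_cover\<close> applies.\<close>
    obtain n where n: "\<And>b. b \<in> letters u \<Longrightarrow> f b < n"
      using finite_letters[OF u] finite_nat_set_iff_bounded[of "f ` letters u"] by auto
    have "letters u \<subseteq> letters (partial_prod n \<omega>)"
      using f n partial_prod_letters[OF \<omega>] by blast
    then have "u \<otimes> partial_prod n \<omega> \<in> capped"
      using capped_cover[OF u] partial_prod_pyr[OF \<omega>, of n] by (simp add: pyr_def)
    then show "\<omega> \<in> (\<Union>n. ?F n)"
      using \<omega> by auto
  qed
  then have "path.prob (\<Union>n. ?F n) = 1"
    using F by (subst path.prob_eq_1) auto
  with limF have "(\<lambda>n. weight u * path.prob (?F n)) \<longlonglongrightarrow> weight u * 1"
    by (intro tendsto_intros) simp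
  \<comment> \<open>The shift of the index by \<open>height u\<close> is constant in
    \<open>n\<close>, so it does not affect the limit.\<close>
  then have "(\<lambda>n. path.prob (?E (n + height u))) \<longlonglongrightarrow> weight u"
    using prob_divides_partial_prod[OF u] by simp
  then have "path.prob (\<Union>n. ?E n) = weight u"
    using LIMSEQ_ignore_initial_segment[OF limE, of "height u"] LIMSEQ_unique by blast
  moreover have "(\<Union>n. ?E n) = {\<omega> \<in> space path_measure. \<exists>n. u divides partial_prod n \<omega>}"
    by auto
  ultimately show ?thesis by simp
qed

section \<open>The limit point in the boundary and its law\<close>

lemma partial_prod_nondecreasing:
  "\<omega> \<in> streams (pyr (Suc 0)) \<Longrightarrow> (\<lambda>n. partial_prod n \<omega>) \<in> nondecreasing_seqs G"
  using partial_prod_carrier partial_prod_divides by (auto simp: nondecreasing_seqs_def)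

lemma seq_le_trans:
  assumes "u \<in> nondecreasing_seqs G" "seq_le G u v" "seq_le G v w"
  shows "seq_le G u w"
  unfolding seq_le_def
proof
  fix k
  obtain i j where "u k divides v i" "v i divides w j"
    using assms(2,3) unfolding seq_le_def by blast
  moreover have "u k \<in> carrier G"
    using assms(1) by (simp add: nondecreasing_seqs_def)
  ultimately show "\<exists>j. u k divides w j"
    using divides_trans by blast
qed

lemma seq_equiv_self: "u \<in> nondecreasing_seqs G \<Longrightarrow> (u, u) \<in> seq_equiv G"
  unfolding seq_equiv_def seq_le_def nondecreasing_seqs_def using divides_refl by blast

lemma const_nondecreasing: "u \<in> carrier G \<Longrightarrow> (\<lambda>_. u) \<in> nondecreasing_seqs G"
  by (auto simp: nondecreasing_seqs_def)

text \<open>Were the limit an element \<open>v\<close> of the monoid, every partial product would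
  divide \<open>v\<close>. But divisors of \<open>v\<close> have height at most
  \<open>height v\<close>, and a product of \<open>Suc (height v)\<close> pyramids exceeds
  it.\<close>

lemma limit_point_boundary:
  assumes "\<omega> \<in> streams (pyr (Suc 0))"
  shows "limit_point \<omega> \<in> monoid_boundary G"
proof -
  let ?T = "\<lambda>n. partial_prod n \<omega>"
  note nd = partial_prod_nondecreasing[OF assms]
  have "limit_point \<omega> \<noteq> gen_embed G v" if v: "v \<in> carrier G" for v
  proof
    assume "limit_point \<omega> = gen_embed G v"
    then have "(\<lambda>_. v, ?T) \<in> seq_equiv G"
      using seq_equiv_self[OF nd] by (auto simp: limit_point_def gen_embed_def)
    then have "?T (Suc (height v)) divides v"
      by (auto simp: seq_equiv_def seq_le_def simp del: partial_prod.simps)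
    then obtain z where "z \<in> carrier G" "v = ?T (Suc (height v)) \<otimes> z"
      unfolding factor_def by blast
    then have "height v = height (?T (Suc (height v))) + height z"
      using height_mult partial_prod_carrier[OF assms] by metis
    moreover have "height (?T (Suc (height v))) = Suc (height v)"
      using partial_prod_pyr[OF assms, of "Suc (height v)"]
      by (simp add: pyr_def del: partial_prod.simps)
    ultimately show False by linarith
  qed
  moreover have "limit_point \<omega> \<in> generalized_elements G"
    unfolding limit_point_def generalized_elements_def using nd by (rule quotientI)
  ultimately show ?thesis
    by (auto simp: monoid_boundary_def)
qed

text \<open>\<open>gen_le\<close> only compares some representatives of the two classes;
  transitivity of \<open>seq_le\<close> transfers the comparison to the constant sequence and the
  partial products themselves.\<close>

lemma limit_point_in_cylinder_iff:
  assumes \<omega>: "\<omega> \<in> streams (pyr (Suc 0))" and u: "u \<in> carrier G"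
  shows "limit_point \<omega> \<in> cylinder G u \<longleftrightarrow> (\<exists>n. u divides partial_prod n \<omega>)"
proof -
  let ?T = "\<lambda>n. partial_prod n \<omega>" and ?u = "\<lambda>_::nat. u"
  have "gen_le G (gen_embed G u) (limit_point \<omega>) \<longleftrightarrow> seq_le G ?u ?T"
  proof
    assume "gen_le G (gen_embed G u) (limit_point \<omega>)"
    then obtain x y where "(?u, x) \<in> seq_equiv G" "(?T, y) \<in> seq_equiv G" "seq_le G x y"
      by (auto simp: gen_le_def gen_embed_def limit_point_def)
    then show "seq_le G ?u ?T"
      unfolding seq_equiv_def by (blast intro: seq_le_trans)
  next
    assume "seq_le G ?u ?T"
    then show "gen_le G (gen_embed G u) (limit_point \<omega>)"
      using seq_equiv_self[OF const_nondecreasing[OF u]]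
        seq_equiv_self[OF partial_prod_nondecreasing[OF \<omega>]]
      by (auto simp: gen_le_def gen_embed_def limit_point_def)
  qed
  then show ?thesis
    using limit_point_boundary[OF \<omega>] by (simp add: cylinder_def seq_le_def)
qed

lemma limit_point_vimage_cylinder:
  assumes "u \<in> carrier G"
  shows "limit_point -` cylinder G u \<inter> space path_measure
    = {\<omega> \<in> space path_measure. \<exists>n. u divides partial_prod n \<omega>}"
  using limit_point_in_cylinder_iff[OF _ assms] by auto

lemma cylinder_subset: "cylinder G ` carrier G \<subseteq> Pow (monoid_boundary G)"
  by (auto simp: cylinder_def)

lemma measurable_limit_point:
  "limit_point \<in> path_measure \<rightarrow>\<^sub>M sigma (monoid_boundary G) (cylinder G ` carrier G)"
proof (rule measurable_measure_of[OF cylinder_subset])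
  show "limit_point \<in> space path_measure \<rightarrow> monoid_boundary G"
    using limit_point_boundary by auto
  fix C assume "C \<in> cylinder G ` carrier G"
  then obtain u where u: "u \<in> carrier G" "C = cylinder G u"
    by blast
  have "(\<Union>n. {\<omega> \<in> space path_measure. partial_prod n \<omega> \<in> {x. u divides x}}) \<in> sets path_measure"
    using measurable_partial_prod by blast
  also have "(\<Union>n. {\<omega> \<in> space path_measure. partial_prod n \<omega> \<in> {x. u divides x}})
      = limit_point -` C \<inter> space path_measure"
    unfolding u(2) limit_point_vimage_cylinder[OF u(1)] by auto
  finally show "limit_point -` C \<inter> space path_measure \<in> sets path_measure" .
qed

lemma measure_boundary_law_cylinder:
  assumes "u \<in> carrier G"
  shows "measure boundary_law (cylinder G u) = weight u"
proof -
  have "cylinder G u \<in> sets (sigma (monoid_boundary G) (cylinder G ` carrier G))"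
    using assms cylinder_subset by (simp add: sigma_sets.Basic)
  then show ?thesis
    unfolding boundary_law_def
    by (subst measure_distr[OF measurable_limit_point])
      (simp_all only: limit_point_vimage_cylinder[OF assms] prob_divides_limit[OF assms])
qed

theorem bernoulli_measure_boundary_law: "bernoulli_measure G boundary_law"
  unfolding bernoulli_measure_def
proof (intro conjI ballI)
  show "prob_space boundary_law"
    unfolding boundary_law_def by (rule path.prob_space_distr[OF measurable_limit_point])
  show "space boundary_law = monoid_boundary G"
    using cylinder_subset by (simp add: boundary_law_def space_measure_of)
  show "sets boundary_law = sigma_sets (monoid_boundary G) (cylinder G ` carrier G)"
    using cylinder_subset by (simp add: boundary_law_def)
qed (simp_all add: measure_boundary_law_cylinder weight_pos weight_mult)

end

section \<open>Pyramids of a trace monoid\<close>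

locale trace_letter =
  fixes \<Sigma> :: "'a set" and I :: "('a \<times> 'a) set" and a :: 'a
  assumes ind: "independence_pair \<Sigma> I" and a_in: "a \<in> \<Sigma>"
begin

lemma finite_alphabet: "finite \<Sigma>" and I_subset: "I \<subseteq> \<Sigma> \<times> \<Sigma>"
  and I_irrefl: "(c, c) \<notin> I" and I_sym: "(c, d) \<in> I \<Longrightarrow> (d, c) \<in> I"
  using ind by (auto simp: independence_pair_def irrefl_def sym_def)

abbreviation cong :: "('a list \<times> 'a list) set" where
  "cong \<equiv> trace_cong \<Sigma> I"

abbreviation G :: "'a list set monoid" where
  "G \<equiv> trace_monoid \<Sigma> I"

definition cls :: "'a list \<Rightarrow> 'a list set" where
  "cls x = cong `` {x}"

text \<open>Evaluation at a chosen representative; for functions constant on congruence classes the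
  choice is immaterial, by \<open>lift_cls\<close>.\<close>

definition lift :: "('a list \<Rightarrow> 'b) \<Rightarrow> 'a list set \<Rightarrow> 'b" where
  "lift f u = f (SOME x. x \<in> u)"

text \<open>A letter of a word is maximal in its trace iff no later letter depends on it.\<close>

fun word_capped :: "'a list \<Rightarrow> bool" where
  "word_capped [] \<longleftrightarrow> True"
| "word_capped (c # x) \<longleftrightarrow> (c = a \<or> (\<exists>d\<in>set x. (c, d) \<notin> I)) \<and> word_capped x"

text \<open>Reading from the right and restarting at every \<open>a\<close>, \<open>base\<close> keeps the letters that must precede
  the first \<open>a\<close> of a word, together with this \<open>a\<close>.\<close>

definition base_step :: "'a \<Rightarrow> 'a list \<Rightarrow> 'a list" where
  "base_step c k = (if c = a then [a] else if \<exists>d\<in>set k. (c, d) \<notin> I then c # k else k)"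

abbreviation base :: "'a list \<Rightarrow> 'a list" where
  "base x \<equiv> foldr base_step x []"

lemma cong_in_lists: "(x, y) \<in> cong \<Longrightarrow> x \<in> lists \<Sigma> \<and> y \<in> lists \<Sigma>"
  using trace_cong_lists[OF I_subset] .

lemma cls_eq_iff:
  assumes "x \<in> lists \<Sigma>" "y \<in> lists \<Sigma>"
  shows "cls x = cls y \<longleftrightarrow> (x, y) \<in> cong"
  unfolding cls_def using assms by (intro eq_equiv_class_iff[OF equiv_trace_cong[OF I_subset]])

lemma cls_in_carrier: "x \<in> lists \<Sigma> \<Longrightarrow> cls x \<in> carrier G"
  by (simp add: cls_def trace_monoid_def quotientI)

lemma carrier_cases:
  assumes "u \<in> carrier G"
  obtains x where "x \<in> lists \<Sigma>" "u = cls x"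
  using assms quotientE[of u "lists \<Sigma>" cong thesis] by (simp add: cls_def trace_monoid_def)

lemma cls_mult:
  "\<lbrakk>x \<in> lists \<Sigma>; y \<in> lists \<Sigma>\<rbrakk> \<Longrightarrow> cls x \<otimes>\<^bsub>G\<^esub> cls y = cls (x @ y)"
  unfolding cls_def by (rule trace_mult_class[OF I_subset])

lemma one_eq_cls: "\<one>\<^bsub>G\<^esub> = cls []"
  by (simp add: cls_def trace_monoid_def)

lemma lift_cls:
  assumes "x \<in> lists \<Sigma>" and inv: "\<And>y z. (y, z) \<in> cong \<Longrightarrow> f y = f z"
  shows "lift f (cls x) = f x"
proof -
  have "(SOME y. y \<in> cls x) \<in> cls x"
    using trace_cong.refl[OF assms(1)] unfolding cls_def Image_singleton_iff by (rule someI)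
  then have "(x, SOME y. y \<in> cls x) \<in> cong"
    unfolding cls_def Image_singleton_iff .
  then show ?thesis
    unfolding lift_def by (rule inv[symmetric])
qed

section \<open>Invariants of the trace congruence and left cancellation\<close>

lemma cong_mset: "(x, y) \<in> cong \<Longrightarrow> mset x = mset y"
  by (induction rule: trace_cong.induct) auto

lemma cong_set: "(x, y) \<in> cong \<Longrightarrow> set x = set y"
  using cong_mset mset_eq_setD by blast

lemma cong_count: "(x, y) \<in> cong \<Longrightarrow> count_list x c = count_list y c"
  using cong_mset by (metis count_mset)

lemma cong_other: "(x, y) \<in> cong \<Longrightarrow> length (filter (\<lambda>c. c \<noteq> a) x) = length (filter (\<lambda>c. c \<noteq> a) y)"
  using cong_mset by (metis mset_filter size_mset)

text \<open>The letters of \<open>x\<close> see the word behind them only through its set of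
  letters.\<close>

lemma word_capped_append_cong: "\<lbrakk>word_capped y = word_capped y'; set y = set y'\<rbrakk> \<Longrightarrow> word_capped (x @ y) = word_capped (x @ y')"
  by (induction x) auto

text \<open>Of two swapped letters neither depends on the other, so the swap changes for neither
  whether a later letter depends on it. The arbitrary suffix \<open>y\<close> makes the induction
  pass through concatenation.\<close>

lemma cong_capped_append: "(x, x') \<in> cong \<Longrightarrow> word_capped (x @ y) = word_capped (x' @ y)"
proof (induction arbitrary: y rule: trace_cong.induct)
  case (comm c d)
  then show ?case
    using I_sym by auto
next
  case (append x x' z z')
  then show ?case
    using word_capped_append_cong[of "z @ y" "z' @ y" x'] cong_set[of z z'] by simp
qed simp_all

lemma cong_capped: "(x, x') \<in> cong \<Longrightarrow> word_capped x = word_capped x'"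
  using cong_capped_append[of x x' "[]"] by simp

lemma word_capped_append: "\<lbrakk>word_capped x; word_capped y\<rbrakk> \<Longrightarrow> word_capped (x @ y)"
  by (induction x) auto

lemma word_capped_appendD: "word_capped (x @ y) \<Longrightarrow> word_capped y"
  by (induction x) auto

text \<open>Each letter of \<open>x\<close> occurs again in \<open>y\<close>, and a letter depends
  on itself because \<open>I\<close> is irreflexive.\<close>

lemma word_capped_cover: "\<lbrakk>word_capped y; set x \<subseteq> set y\<rbrakk> \<Longrightarrow> word_capped (x @ y)"
  using I_irrefl by (induction x) auto

lemma word_capped_last: "\<lbrakk>word_capped x; x \<noteq> []\<rbrakk> \<Longrightarrow> last x = a"
  by (induction x rule: word_capped.induct) (auto split: if_splits)

lemma word_capped_count_0: "\<lbrakk>word_capped x; count_list x a = 0\<rbrakk> \<Longrightarrow> x = []"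
  using word_capped_last[of x] last_in_set[of x] by (auto simp: count_list_0_iff)

lemma word_capped_count_1:
  assumes "word_capped x" "count_list x a = 1"
  obtains v where "x = v @ [a]" "a \<notin> set v"
proof -
  from assms(2) have "x \<noteq> []" by auto
  then have x: "x = butlast x @ [a]"
    using word_capped_last[OF assms(1)] append_butlast_last_id[of x] by metis
  with assms(2) have "count_list (butlast x) a = 0"
    using count_list_append[of "butlast x" "[a]" a] by simp
  then show thesis
    using that[OF x] by (simp add: count_list_0_iff)
qed

text \<open>Serves cancellation: removing the first \<open>c\<close> from \<open>c # w\<close>
  leaves \<open>w\<close>, so a common prefix can be stripped letter by letter.\<close>

lemma cong_remove1: "(x, y) \<in> cong \<Longrightarrow> (remove1 c x, remove1 c y) \<in> cong"
proof (induction rule: trace_cong.induct)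
  case (refl x)
  then have "set (remove1 c x) \<subseteq> \<Sigma>"
    using set_remove1_subset[of c x] by auto
  then show ?case
    by (intro trace_cong.refl) auto
next
  case (comm d e)
  then have "d \<in> \<Sigma>" "e \<in> \<Sigma>"
    using I_subset by auto
  with comm show ?case
    by (auto intro!: trace_cong.refl intro: trace_cong.comm)
next
  case (append x x' y y')
  then show ?case
    using cong_set[OF append.hyps(1)] by (auto simp: remove1_append intro: trace_cong.append)
qed (blast intro: trace_cong.sym trace_cong.trans)+

lemma cong_cancel: "(x @ y, x @ z) \<in> cong \<Longrightarrow> (y, z) \<in> cong"
proof (induction x)
  case (Cons c x)
  then show ?case
    using cong_remove1[of "(c # x) @ y" "(c # x) @ z" c] by simp
qed simp

section \<open>Extracting the first pyramid of a word\<close>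

lemma base_step_cong:
  assumes "(k, k') \<in> cong" "c \<in> \<Sigma>"
  shows "(base_step c k, base_step c k') \<in> cong"
proof -
  have "([c] @ k, [c] @ k') \<in> cong"
    using assms by (intro trace_cong.append trace_cong.refl) auto
  then show ?thesis
    using assms cong_set[OF assms(1)] a_in by (auto simp: base_step_def intro!: trace_cong.refl)
qed

text \<open>Congruent accumulators are allowed so that concatenation goes through. For independent
  \<open>c\<close> and \<open>d\<close> both different from \<open>a\<close>, keeping one does not
  influence whether the other is kept; if one of them is \<open>a\<close>, both orders give
  \<open>[a]\<close>.\<close>

lemma foldr_base_step_cong:
  "\<lbrakk>(x, x') \<in> cong; (k, k') \<in> cong\<rbrakk> \<Longrightarrow> (foldr base_step x k, foldr base_step x' k') \<in> cong"
proof (induction arbitrary: k k' rule: trace_cong.induct)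
  case (refl x)
  then show ?case
    by (induction x) (auto intro: base_step_cong)
next
  case (sym x y)
  then show ?case
    by (blast intro: trace_cong.sym)
next
  case (trans x y z)
  then show ?case
    using cong_in_lists[OF trans.prems] by (blast intro: trace_cong.trans trace_cong.refl)
next
  case (comm c d)
  have cd: "c \<in> \<Sigma>" "d \<in> \<Sigma>" "(d, c) \<in> I" "c \<noteq> d"
    using comm.hyps I_subset I_sym I_irrefl by auto
  have swap: "([c, d] @ k, [d, c] @ k') \<in> cong"
    using comm by (intro trace_cong.append trace_cong.comm)
  have one: "([e] @ k, [e] @ k') \<in> cong" if "e \<in> \<Sigma>" for e
    using that comm.prems by (intro trace_cong.append trace_cong.refl) auto
  show ?case
    using swap one[OF cd(1)] one[OF cd(2)] comm cd cong_set[OF comm.prems] a_in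
    by (auto simp: base_step_def intro!: trace_cong.refl)
qed (simp add: foldr_append)

lemma base_cong: "(x, x') \<in> cong \<Longrightarrow> (base x, base x') \<in> cong"
  by (rule foldr_base_step_cong) (auto intro: trace_cong.refl)

text \<open>At \<open>a\<close> the fold forgets everything to its right, and every letter of
  \<open>v\<close> is kept since some letter after it in \<open>v @ [a]\<close> depends on it. Hence
  the first pyramid can be recovered from the product.\<close>

lemma base_pyramid:
  assumes "word_capped (v @ [a])" "a \<notin> set v"
  shows "base (v @ [a] @ y) = v @ [a]"
proof -
  have "foldr base_step (v @ [a]) k = v @ [a]" for k
    using assms by (induction v) (auto simp: base_step_def)
  then show ?thesis
    by (metis append_assoc foldr_append o_apply)
qed

lemma base_in_lists: "x \<in> lists \<Sigma> \<Longrightarrow> base x \<in> lists \<Sigma>"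
  using a_in by (induction x) (auto simp: base_step_def)

lemma base_capped: "word_capped (base x)"
  by (induction x) (auto simp: base_step_def)

lemma base_count: "a \<in> set x \<Longrightarrow> count_list (base x) a = 1"
  by (induction x) (auto simp: base_step_def)

lemma cong_commute:
  "\<lbrakk>c \<in> \<Sigma>; k \<in> lists \<Sigma>; \<forall>d\<in>set k. (c, d) \<in> I\<rbrakk> \<Longrightarrow> (c # k, k @ [c]) \<in> cong"
proof (induction k)
  case Nil
  then show ?case by (auto intro: trace_cong.refl)
next
  case (Cons d k)
  have "([c, d] @ k, [d, c] @ k) \<in> cong"
    using Cons.prems by (intro trace_cong.append trace_cong.comm trace_cong.refl) auto
  moreover have "([d] @ (c # k), [d] @ (k @ [c])) \<in> cong"
    using Cons by (intro trace_cong.append trace_cong.refl) auto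
  ultimately show ?case
    by (auto intro: trace_cong.trans)
qed

text \<open>A new letter in front is either kept before \<open>base x\<close> or, being independent
  of everything in it, moved behind it into the remainder. A new \<open>a\<close> restarts the base
  as \<open>[a]\<close> and turns the whole old word into the remainder.\<close>

lemma base_prefix:
  "\<lbrakk>x \<in> lists \<Sigma>; a \<in> set x\<rbrakk> \<Longrightarrow> \<exists>r\<in>lists \<Sigma>. (x, base x @ r) \<in> cong"
proof (induction x)
  case (Cons c x)
  show ?case
  proof (cases "c = a")
    case True
    then show ?thesis
      using Cons.prems by (intro bexI[of _ x]) (auto simp: base_step_def intro!: trace_cong.refl)
  next
    case False
    with Cons obtain r where r: "r \<in> lists \<Sigma>" "(x, base x @ r) \<in> cong"
      by auto
    have c: "c \<in> \<Sigma>" and x: "x \<in> lists \<Sigma>"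
      using Cons.prems by auto
    have cx: "([c] @ x, [c] @ (base x @ r)) \<in> cong"
      using r c by (intro trace_cong.append trace_cong.refl) auto
    show ?thesis
    proof (cases "\<exists>d\<in>set (base x). (c, d) \<notin> I")
      case True
      then show ?thesis
        using cx r(1) False by (intro bexI[of _ r]) (simp_all add: base_step_def[of c "base x"])
    next
      case indep: False
      have "((c # base x) @ r, (base x @ [c]) @ r) \<in> cong"
        using c base_in_lists[OF x] indep r(1)
        by (intro trace_cong.append cong_commute trace_cong.refl) auto
      with cx have "(c # x, base x @ (c # r)) \<in> cong"
        by (auto intro: trace_cong.trans)
      then show ?thesis
        using indep False r(1) c by (intro bexI[of _ "c # r"]) (auto simp: base_step_def[of c "base x"])
    qed
  qed
qed simp

section \<open>Pyramids as traces: passing from words to classes\<close>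

definition height :: "'a list set \<Rightarrow> nat" where
  "height = lift (\<lambda>x. count_list x a)"

definition other :: "'a list set \<Rightarrow> nat" where
  "other = lift (\<lambda>x. length (filter (\<lambda>c. c \<noteq> a) x))"

definition letters :: "'a list set \<Rightarrow> 'a set" where
  "letters = lift set"

definition capped :: "'a list set set" where
  "capped = {u \<in> carrier G. lift word_capped u}"

definition pyramids :: "'a list set set" where
  "pyramids = {w \<in> capped. height w = 1}"

lemma height_cls [simp]: "x \<in> lists \<Sigma> \<Longrightarrow> height (cls x) = count_list x a"
  unfolding height_def by (rule lift_cls[OF _ cong_count])

lemma other_cls [simp]:
  "x \<in> lists \<Sigma> \<Longrightarrow> other (cls x) = length (filter (\<lambda>c. c \<noteq> a) x)"
  unfolding other_def by (rule lift_cls[OF _ cong_other])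

lemma letters_cls [simp]: "x \<in> lists \<Sigma> \<Longrightarrow> letters (cls x) = set x"
  unfolding letters_def by (rule lift_cls[OF _ cong_set])

lemma cls_in_capped [simp]: "x \<in> lists \<Sigma> \<Longrightarrow> cls x \<in> capped \<longleftrightarrow> word_capped x"
  unfolding capped_def using lift_cls[OF _ cong_capped] cls_in_carrier by simp

lemma capped_carrier: "capped \<subseteq> carrier G"
  by (auto simp: capped_def)

lemma capped_cases:
  assumes "u \<in> capped"
  obtains x where "x \<in> lists \<Sigma>" "u = cls x" "word_capped x"
  using assms capped_carrier carrier_cases[of u] cls_in_capped by (metis subset_iff)

lemma pyramid_cases:
  assumes "w \<in> capped" "height w = 1"
  obtains v where "v \<in> lists \<Sigma>" "a \<notin> set v" "word_capped (v @ [a])" "w = cls (v @ [a])"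
proof -
  from assms(1) obtain x where x: "x \<in> lists \<Sigma>" "w = cls x" "word_capped x"
    by (rule capped_cases)
  moreover from x assms(2) have "count_list x a = 1"
    by simp
  then obtain v where "x = v @ [a]" "a \<notin> set v"
    using word_capped_count_1[OF x(3)] by blast
  ultimately show thesis
    using that[of v] by auto
qed

lemma trace_left_cancel:
  assumes "u \<in> carrier G" "x \<in> carrier G" "y \<in> carrier G" "u \<otimes>\<^bsub>G\<^esub> x = u \<otimes>\<^bsub>G\<^esub> y"
  shows "x = y"
proof -
  obtain u' x' y' where *: "u' \<in> lists \<Sigma>" "x' \<in> lists \<Sigma>" "y' \<in> lists \<Sigma>"
    "u = cls u'" "x = cls x'" "y = cls y'"
    using assms by (metis carrier_cases)
  then have "(u' @ x', u' @ y') \<in> cong"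
    using assms(4) by (simp add: cls_mult cls_eq_iff)
  then show ?thesis
    using cong_cancel * by (simp add: cls_eq_iff)
qed

text \<open>The class of \<open>base z\<close> is the required pyramid, with the remainder from
  \<open>base_prefix\<close> as cofactor.\<close>

lemma trace_first_pyramid_exists:
  assumes "x \<in> capped" "height x = Suc n"
  shows "\<exists>w\<in>capped. \<exists>y\<in>carrier G. height w = 1 \<and> x = w \<otimes>\<^bsub>G\<^esub> y"
proof -
  from assms(1) obtain z where z: "z \<in> lists \<Sigma>" "x = cls z" "word_capped z"
    by (rule capped_cases)
  then have az: "a \<in> set z"
    using assms(2) by (metis height_cls count_notin Zero_not_Suc)
  then obtain r where r: "r \<in> lists \<Sigma>" "(z, base z @ r) \<in> cong"
    using base_prefix[OF z(1)] by blast
  note b = base_in_lists[OF z(1)]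
  have "x = cls (base z) \<otimes>\<^bsub>G\<^esub> cls r"
    using r b z by (simp add: cls_mult cls_eq_iff)
  moreover have "cls (base z) \<in> capped" "height (cls (base z)) = 1"
    using b base_capped base_count[OF az] by simp_all
  ultimately show ?thesis
    using cls_in_carrier[OF r(1)] by blast
qed

lemma trace_first_pyramid_unique:
  assumes "w \<in> capped" "w' \<in> capped" "height w = 1" "height w' = 1"
    and "y \<in> carrier G" "y' \<in> carrier G" "w \<otimes>\<^bsub>G\<^esub> y = w' \<otimes>\<^bsub>G\<^esub> y'"
  shows "w = w'"
proof -
  obtain v where v: "v \<in> lists \<Sigma>" "a \<notin> set v" "word_capped (v @ [a])" "w = cls (v @ [a])"
    using assms(1,3) by (rule pyramid_cases)
  obtain v' where v': "v' \<in> lists \<Sigma>" "a \<notin> set v'" "word_capped (v' @ [a])" "w' = cls (v' @ [a])"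
    using assms(2,4) by (rule pyramid_cases)
  obtain z z' where z: "z \<in> lists \<Sigma>" "y = cls z" "z' \<in> lists \<Sigma>" "y' = cls z'"
    using assms(5,6) by (metis carrier_cases)
  have "((v @ [a]) @ z, (v' @ [a]) @ z') \<in> cong"
    using assms(7) v v' z a_in by (simp add: cls_mult cls_eq_iff)
  \<comment> \<open>\<open>base\<close> respects the congruence and returns a leading pyramid
    unchanged, whatever follows it.\<close>
  from base_cong[OF this] have "(v @ [a], v' @ [a]) \<in> cong"
    using base_pyramid[OF v(3,2), of z] base_pyramid[OF v'(3,2), of z'] by simp
  then show ?thesis
    using v v' a_in by (simp add: cls_eq_iff)
qed

text \<open>Follow a path from \<open>b\<close> to \<open>a\<close> in the dependence graph
  backwards, starting from \<open>[a]\<close>: each vertex is put in front of the word built so far,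
  which contains a letter dependent on it.\<close>

lemma trace_letter_in_pyramid:
  assumes irr: "irreducible_trace_monoid \<Sigma> I" and b: "b \<in> \<Sigma>"
  shows "\<exists>w\<in>capped. height w = 1 \<and> b \<in> letters w"
proof -
  have "(b, a) \<in> (\<Sigma> \<times> \<Sigma> - I)\<^sup>*"
    using irr a_in b by (auto simp: irreducible_trace_monoid_def)
  then have "\<exists>v\<in>lists \<Sigma>. a \<notin> set v \<and> word_capped (v @ [a]) \<and> b \<in> set (v @ [a])"
  proof (induction rule: converse_rtrancl_induct)
    case base
    show ?case by (intro bexI[of _ "[]"]) auto
  next
    case (step b c)
    then obtain v where v: "v \<in> lists \<Sigma>" "a \<notin> set v" "word_capped (v @ [a])" "c \<in> set (v @ [a])"
      by blast
    show ?case
    proof (cases "b = a")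
      \<comment> \<open>The path may revisit \<open>a\<close>, but a pyramid has only one
        \<open>a\<close>; the word then restarts as \<open>[a]\<close>.\<close>
      case True
      then show ?thesis by (intro bexI[of _ "[]"]) auto
    next
      case False
      with v step.hyps(1) show ?thesis
        by (intro bexI[of _ "b # v"]) auto
    qed
  qed
  then obtain v where "v \<in> lists \<Sigma>" "a \<notin> set v" "word_capped (v @ [a])" "b \<in> set (v @ [a])"
    by blast
  then show ?thesis
    using a_in by (intro bexI[of _ "cls (v @ [a])"]) auto
qed

section \<open>The generating series of pyramids\<close>

definition pyramid_number :: "nat \<Rightarrow> nat" where
  "pyramid_number m = card {w \<in> pyramids. other w = m}"

text \<open>This is \<open>Z(s)\<close>: a pyramid contains a single \<open>a\<close>, so its value
  of \<open>other\<close> is its length minus one.\<close>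

definition pyramid_series :: "real \<Rightarrow> real" where
  "pyramid_series s = (\<Sum>m. real (pyramid_number m) * s ^ m)"

text \<open>The value on \<open>a\<close> is chosen so that the pyramids have total weight
  1.\<close>

definition trace_weight :: "real \<Rightarrow> 'a list set \<Rightarrow> real" where
  "trace_weight s u = (1 / pyramid_series s) ^ height u * s ^ other u"

lemma pyramids_of_size:
  "{w \<in> pyramids. other w = m} \<subseteq> (\<lambda>v. cls (v @ [a])) ` {v. set v \<subseteq> \<Sigma> \<and> length v = m}"
proof
  fix w assume "w \<in> {w \<in> pyramids. other w = m}"
  then have w: "w \<in> capped" "height w = 1" "other w = m"
    by (auto simp: pyramids_def)
  then obtain v where v: "v \<in> lists \<Sigma>" "a \<notin> set v" "w = cls (v @ [a])"
    by (meson pyramid_cases)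
  then have "filter (\<lambda>c. c \<noteq> a) v = v"
    by (auto simp: filter_id_conv)
  with v w(3) a_in have "length v = m"
    by simp
  with v show "w \<in> (\<lambda>v. cls (v @ [a])) ` {v. set v \<subseteq> \<Sigma> \<and> length v = m}"
    by auto
qed

lemma finite_pyramids_of_size: "finite {w \<in> pyramids. other w = m}"
  by (rule finite_subset[OF pyramids_of_size]) (intro finite_imageI finite_lists_length_eq finite_alphabet)

text \<open>A crude count by words \<open>v\<close> of length \<open>m\<close>, enough to compare
  the series with a geometric one and obtain convergence whenever \<open>0 \<le> s\<close> and
  \<open>s * card \<Sigma> < 1\<close>.\<close>

lemma pyramid_number_le: "pyramid_number m \<le> card \<Sigma> ^ m"
proof -
  have fin: "finite {v. set v \<subseteq> \<Sigma> \<and> length v = m}"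
    by (rule finite_lists_length_eq[OF finite_alphabet])
  have "pyramid_number m \<le> card ((\<lambda>v. cls (v @ [a])) ` {v. set v \<subseteq> \<Sigma> \<and> length v = m})"
    unfolding pyramid_number_def by (intro card_mono pyramids_of_size finite_imageI fin)
  also have "\<dots> \<le> card {v. set v \<subseteq> \<Sigma> \<and> length v = m}"
    by (rule card_image_le[OF fin])
  also have "\<dots> = card \<Sigma> ^ m"
    by (rule card_lists_length_eq[OF finite_alphabet])
  finally show ?thesis .
qed

text \<open>The letter \<open>a\<close> alone is a pyramid; this constant term keeps the series
  positive.\<close>

lemma pyramid_number_0: "pyramid_number 0 > 0"
proof -
  have "cls [a] \<in> {w \<in> pyramids. other w = 0}"
    using a_in by (auto simp: pyramids_def)
  then show ?thesis
    unfolding pyramid_number_def using finite_pyramids_of_size[of 0]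
    by (metis card_gt_0_iff empty_iff)
qed

lemma summable_pyramid_series:
  fixes s :: real
  assumes "0 \<le> s" "s * real (card \<Sigma>) < 1"
  shows "summable (\<lambda>m. real (pyramid_number m) * s ^ m)"
proof (rule summable_comparison_test[OF exI, of 0])
  show "\<forall>m\<ge>0. norm (real (pyramid_number m) * s ^ m) \<le> (s * real (card \<Sigma>)) ^ m"
  proof (intro allI impI)
    fix m
    have "real (pyramid_number m) \<le> real (card \<Sigma>) ^ m"
      using pyramid_number_le[of m] by (metis of_nat_le_iff of_nat_power)
    then have "real (pyramid_number m) * s ^ m \<le> real (card \<Sigma>) ^ m * s ^ m"
      using assms(1) by (intro mult_right_mono) auto
    then show "norm (real (pyramid_number m) * s ^ m) \<le> (s * real (card \<Sigma>)) ^ m"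
      using assms(1) by (simp add: power_mult_distrib mult.commute)
  qed
  show "summable (\<lambda>m. (s * real (card \<Sigma>)) ^ m)"
    using assms by (intro summable_geometric) simp
qed

lemma pyramid_series_pos:
  fixes s :: real
  assumes "0 \<le> s" "s * real (card \<Sigma>) < 1"
  shows "pyramid_series s > 0"
  unfolding pyramid_series_def
  using pyramid_number_0 assms(1)
  by (intro suminf_pos2[OF summable_pyramid_series[OF assms], of 0]) auto

text \<open>A power series that converges at \<open>r\<close> is continuous strictly inside that
  radius, hence the half-open interval.\<close>

lemma continuous_on_pyramid_series:
  fixes r :: real
  assumes "0 \<le> r" "r * real (card \<Sigma>) < 1"
  shows "continuous_on {0..<r} pyramid_series"
proof (intro continuous_at_imp_continuous_on ballI)
  fix s assume "s \<in> {0..<r}"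
  then show "isCont pyramid_series s"
    unfolding pyramid_series_def
    by (intro isCont_powser[OF summable_pyramid_series[OF assms]]) auto
qed

text \<open>Group the pyramids by \<open>other\<close>: level \<open>m\<close> is finite, with
  \<open>pyramid_number m\<close> members of mass \<open>s ^ m\<close> each.\<close>

lemma nn_integral_pyramids:
  fixes s :: real
  assumes s: "0 \<le> s" "s * real (card \<Sigma>) < 1"
  shows "(\<integral>\<^sup>+w. ennreal (s ^ other w) \<partial>count_space pyramids) = ennreal (pyramid_series s)"
proof -
  have "(\<integral>\<^sup>+w. ennreal (s ^ other w) \<partial>count_space pyramids)
      = (\<integral>\<^sup>+w. (\<Sum>m. ennreal (s ^ m) * indicator {w \<in> pyramids. other w = m} w) \<partial>count_space pyramids)"
  proof (intro nn_integral_cong)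
    fix w assume w: "w \<in> space (count_space pyramids)"
    have "ennreal (s ^ other w)
        = (\<Sum>m\<in>{other w}. ennreal (s ^ m) * indicator {w \<in> pyramids. other w = m} w)"
      using w by simp
    also have "\<dots> = (\<Sum>m. ennreal (s ^ m) * indicator {w \<in> pyramids. other w = m} w)"
      by (intro suminf_finite[symmetric]) auto
    finally show "ennreal (s ^ other w)
        = (\<Sum>m. ennreal (s ^ m) * indicator {w \<in> pyramids. other w = m} w)" .
  qed
  also have "\<dots> = (\<Sum>m. \<integral>\<^sup>+w. ennreal (s ^ m) * indicator {w \<in> pyramids. other w = m} w \<partial>count_space pyramids)"
    by (intro nn_integral_suminf) simp
  also have "\<dots> = (\<Sum>m. ennreal (real (pyramid_number m) * s ^ m))"
  proof (intro suminf_cong)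
    fix m
    have "(\<integral>\<^sup>+w. ennreal (s ^ m) * indicator {w \<in> pyramids. other w = m} w \<partial>count_space pyramids)
        = ennreal (s ^ m) * emeasure (count_space pyramids) {w \<in> pyramids. other w = m}"
      by (intro nn_integral_cmult_indicator) auto
    also have "emeasure (count_space pyramids) {w \<in> pyramids. other w = m} = ennreal (real (pyramid_number m))"
      using finite_pyramids_of_size by (simp add: emeasure_count_space pyramid_number_def ennreal_of_nat_eq_real_of_nat)
    finally show "(\<integral>\<^sup>+w. ennreal (s ^ m) * indicator {w \<in> pyramids. other w = m} w \<partial>count_space pyramids)
        = ennreal (real (pyramid_number m) * s ^ m)"
      using s(1) by (simp add: ennreal_mult'' mult.commute)
  qed
  also have "\<dots> = ennreal (pyramid_series s)"
    unfolding pyramid_series_def using s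
    by (intro suminf_ennreal2 summable_pyramid_series) auto
  finally show ?thesis .
qed

lemma trace_weight_pyramids:
  fixes s :: real
  assumes s: "0 \<le> s" "s * real (card \<Sigma>) < 1"
  shows "(\<integral>\<^sup>+w. ennreal (trace_weight s w) \<partial>count_space pyramids) = 1"
proof -
  note Z = pyramid_series_pos[OF s]
  have "(\<integral>\<^sup>+w. ennreal (trace_weight s w) \<partial>count_space pyramids)
      = (\<integral>\<^sup>+w. ennreal (1 / pyramid_series s) * ennreal (s ^ other w) \<partial>count_space pyramids)"
    using s Z by (intro nn_integral_cong)
      (simp add: trace_weight_def pyramids_def ennreal_mult'' [symmetric])
  also have "\<dots> = ennreal (1 / pyramid_series s) * ennreal (pyramid_series s)"
    by (subst nn_integral_cmult) (simp_all add: nn_integral_pyramids[OF s])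
  also have "\<dots> = 1"
    using Z by (simp add: ennreal_mult'' [symmetric])
  finally show ?thesis .
qed

section \<open>Verification of the pyramid axioms and continuity of the weights\<close>

lemma trace_pyramid_monoid:
  fixes s :: real
  assumes irr: "irreducible_trace_monoid \<Sigma> I" and s: "0 < s" "s * real (card \<Sigma>) < 1"
  shows "pyramid_monoid G height letters capped (trace_weight s)"
proof -
  interpret monoid G
    by (rule monoid_trace_monoid[OF I_subset])
  have s': "0 \<le> s" using s by simp
  note Z = pyramid_series_pos[OF s' s(2)]
  show ?thesis
  proof unfold_locales
    have "carrier G \<subseteq> cls ` lists \<Sigma>"
      using carrier_cases by blast
    then show "countable (carrier G)"
      by (rule countable_subset)
        (intro countable_image countable_lists countable_finite finite_alphabet)
    show "height \<one>\<^bsub>G\<^esub> = 0" "\<one>\<^bsub>G\<^esub> \<in> capped" "trace_weight s \<one>\<^bsub>G\<^esub> = 1"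
      by (simp_all add: one_eq_cls trace_weight_def)
    show "height (x \<otimes>\<^bsub>G\<^esub> y) = height x + height y"
      "letters (x \<otimes>\<^bsub>G\<^esub> y) = letters x \<union> letters y"
      "trace_weight s (x \<otimes>\<^bsub>G\<^esub> y) = trace_weight s x * trace_weight s y"
      if xy: "x \<in> carrier G" "y \<in> carrier G" for x y
    proof -
      obtain x' where "x' \<in> lists \<Sigma>" "x = cls x'"
        using xy(1) by (rule carrier_cases)
      moreover obtain y' where "y' \<in> lists \<Sigma>" "y = cls y'"
        using xy(2) by (rule carrier_cases)
      ultimately show "height (x \<otimes>\<^bsub>G\<^esub> y) = height x + height y"
        "letters (x \<otimes>\<^bsub>G\<^esub> y) = letters x \<union> letters y"
        "trace_weight s (x \<otimes>\<^bsub>G\<^esub> y) = trace_weight s x * trace_weight s y"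
        by (simp_all add: cls_mult trace_weight_def power_add)
    qed
    show "finite (letters x)" if "x \<in> carrier G" for x
      using that by (elim carrier_cases) simp
    show "x = \<one>\<^bsub>G\<^esub>" if x: "x \<in> capped" "height x = 0" for x
    proof -
      obtain z where z: "z \<in> lists \<Sigma>" "x = cls z" "word_capped z"
        using x(1) by (rule capped_cases)
      then have "z = []"
        using x(2) by (intro word_capped_count_0) simp_all
      with z(2) show ?thesis
        by (simp only: one_eq_cls)
    qed
    show "x \<otimes>\<^bsub>G\<^esub> y \<in> capped" if "x \<in> capped" "y \<in> capped" for x y
      using that by (elim capped_cases) (simp add: cls_mult word_capped_append)
    show "y \<in> capped" if "x \<in> carrier G" "y \<in> carrier G" "x \<otimes>\<^bsub>G\<^esub> y \<in> capped" for x y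
      using that by (elim carrier_cases) (simp add: cls_mult word_capped_appendD)
    show "u \<otimes>\<^bsub>G\<^esub> y \<in> capped" if "u \<in> carrier G" "y \<in> capped" "letters u \<subseteq> letters y" for u y
      using that by (elim carrier_cases capped_cases) (simp add: cls_mult word_capped_cover)
    \<comment> \<open>This is where irreducibility enters.\<close>
    show "\<exists>w\<in>capped. height w = 1 \<and> b \<in> letters w"
      if b: "u \<in> carrier G" "b \<in> letters u" for u b
    proof (rule trace_letter_in_pyramid[OF irr])
      obtain x where "x \<in> lists \<Sigma>" "u = cls x"
        using b(1) by (rule carrier_cases)
      with b(2) have "x \<in> lists \<Sigma>" "b \<in> set x"
        by (simp_all only: letters_cls)
      then show "b \<in> \<Sigma>"
        by auto
    qed
    show "trace_weight s x > 0" if "x \<in> carrier G" for x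
      using s Z by (simp add: trace_weight_def)
    show "(\<integral>\<^sup>+w. ennreal (trace_weight s w) \<partial>count_space {w \<in> capped. height w = 1}) = 1"
      using trace_weight_pyramids[OF s' s(2)] by (simp add: pyramids_def)
    show "capped \<subseteq> carrier G"
      by (rule capped_carrier)
  qed (rule trace_left_cancel trace_first_pyramid_exists trace_first_pyramid_unique; assumption)+
qed

lemma continuous_on_trace_weight:
  fixes r :: real
  assumes "0 \<le> r" "r * real (card \<Sigma>) < 1"
  shows "continuous_on {0..<r} (\<lambda>s. trace_weight s u)"
proof -
  have "pyramid_series s \<noteq> 0" if "s \<in> {0..<r}" for s
  proof -
    have "s * real (card \<Sigma>) \<le> r * real (card \<Sigma>)"
      using that by (intro mult_right_mono) auto
    then show ?thesis
      using pyramid_series_pos[of s] that assms(2) by auto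
  qed
  then show ?thesis
    unfolding trace_weight_def
    by (intro continuous_intros continuous_on_pyramid_series[OF assms]) auto
qed

end

section \<open>The one-parameter family of Bernoulli measures\<close>

theorem proposition2p7:
  fixes \<Sigma> :: "'a set" and I :: "('a \<times> 'a) set"
  assumes "independence_pair \<Sigma> I"
    and "irreducible_trace_monoid \<Sigma> I"
    and "card \<Sigma> > 1"
  shows "\<exists>P. continuous_family_of_bernoulli_measures (trace_monoid \<Sigma> I) P \<and> inj_on P {0..1}"
proof -
  have "finite \<Sigma>"
    using assms(1) by (simp add: independence_pair_def)
  \<comment> \<open>\<open>a\<close> is the letter that caps the pyramids; the weight of
    \<open>b\<close> will recover the parameter.\<close>
  then obtain a b where ab: "a \<in> \<Sigma>" "b \<in> \<Sigma>" "b \<noteq> a"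
    using assms(3) by (metis One_nat_def card_le_Suc0_iff_eq not_le)
  interpret trace_letter \<Sigma> I a
    using assms(1) ab(1) by unfold_locales
  define N where "N = real (card \<Sigma>)"
  have N: "N > 0"
    using assms(3) by (simp add: N_def)
  \<comment> \<open>For \<open>t\<close> in \<open>{0..1}\<close> the value \<open>s t\<close> runs
    from \<open>1 / (4 * N)\<close> to \<open>1 / (2 * N)\<close>: positive, and strictly below
    \<open>r = 3 / (4 * N)\<close>, which itself lies below the bound \<open>1 / N\<close> required
    for convergence.\<close>
  define s where "s t = (1 + t) / (4 * N)" for t :: real
  define r where "r = 3 / (4 * N)"
  have r: "0 \<le> r" "r * real (card \<Sigma>) < 1"
    using N by (auto simp: r_def N_def)
  have s: "s t \<in> {0..<r}" "0 < s t" "s t * real (card \<Sigma>) < 1" if "t \<in> {0..1}" for t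
    using that N by (auto simp: s_def r_def N_def field_simps)
  define P where "P t = pyramid_monoid.boundary_law G height capped (trace_weight (s t))" for t
  have law: "bernoulli_measure G (P t)"
    and val: "u \<in> carrier G \<Longrightarrow> measure (P t) (cylinder G u) = trace_weight (s t) u"
    if "t \<in> {0..1}" for t u
    unfolding P_def
    using pyramid_monoid.bernoulli_measure_boundary_law[OF trace_pyramid_monoid[OF assms(2) s(2,3)[OF that]]]
      pyramid_monoid.measure_boundary_law_cylinder[OF trace_pyramid_monoid[OF assms(2) s(2,3)[OF that]]]
    by auto
  have "continuous_on {0..1} (\<lambda>t. measure (P t) (cylinder G u))" if u: "u \<in> carrier G" for u
  proof -
    have "continuous_on {0..1} (\<lambda>t. trace_weight (s t) u)"
      using s(1) N by (intro continuous_on_compose2[OF continuous_on_trace_weight[OF r]])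
        (auto simp: s_def intro!: continuous_intros)
    then show ?thesis
      by (rule continuous_on_eq) (simp add: val[OF _ u])
  qed
  with law have "continuous_family_of_bernoulli_measures G P"
    by (simp add: continuous_family_of_bernoulli_measures_def)
  moreover have "inj_on P {0..1}"
  proof (rule inj_onI)
    fix t t' :: real assume t: "t \<in> {0..1}" "t' \<in> {0..1}" "P t = P t'"
    have b: "[b] \<in> lists \<Sigma>"
      using ab by simp
    have "trace_weight (s t) (cls [b]) = trace_weight (s t') (cls [b])"
      using val[OF t(1) cls_in_carrier[OF b]] val[OF t(2) cls_in_carrier[OF b]] t(3) by simp
    \<comment> \<open>The word \<open>[b]\<close> has no \<open>a\<close> and one other letter, so
      its weight is the parameter itself.\<close>
    then have "s t = s t'"
      using ab b by (simp add: trace_weight_def)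
    then show "t = t'"
      using N by (simp add: s_def)
  qed
  ultimately show ?thesis
    by blast
qed

end
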